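(* Let $T$ be a nonempty totally ordered set, let $G$ be a totally ordered abelian group of rank one, let $\Gamma \subseteq G^T$ be the totally ordered group of all functions $T \to G$ with well ordered support (lexicographically ordered, as described in the context), and let $O_v$ be a valuation domain whose value group is $\Gamma$. Then the map $t \mapsto H_t$ ($t\in T$) is an order reversing bijection between $T$ and $\mathrm{IS}(\mathrm{isolated}(\Gamma))$. Consequently, there exists an isomorphism of totally ordered sets between $T$ and $\mathrm{IP}(\mathrm{Spec}(O_v))$, and hence an isomorphism of totally ordered sets between $T$ and $\mathrm{IS}(\mathrm{Spec}(O_v))$.
   Context: A totally ordered abelian group has rank one if it is nonzero and its only isolated subgroups are $\{0\}$ and itself (equivalently, it is nonzero and archimedean). $G^T$ is the group of all functions $T\to G$ with componentwise addition; $\mathrm{supp}(f)=\{t\in T \mid f(t)\neq 0\}$; $\Gamma$ is the subgroup of all $f\in G^T$ with well ordered support. $\Gamma$ is totally ordered by: $f\le g$ iff $f=g$ or, for the smallest $t\in \mathrm{supp}(f)\cup \mathrm{supp}(g)$ such that $f(t)\neq g(t)$, one has $f(t)<g(t)$ (left to right lexicographic order). An isolated subgroup of $\Gamma$ is a subgroup $H$ such that for every $0\le h\in H$ and every $g\in\Gamma$ with $0\le g\le h$ one has $g\in H$. $\mathrm{isolated}(\Gamma)$ is the set of all isolated subgroups of $\Gamma$ (including $\{0\}$ and $\Gamma$), ordered by inclusion. For $t\in T$, $H_t=\{f\in\Gamma \mid f(s)=0 \text{ for all } s\in T \text{ with } s<t\}$. For a poset $S$, $a,b\in S$ are immediate neighbors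 if $a<b$ and there is no $c\in S$ with $a<c<b$; then $a$ is an immediate predecessor of $b$ and $b$ an immediate successor of $a$. $\mathrm{IS}(S)$ is the set of elements of $S$ having an immediate predecessor in $S$, and $\mathrm{IP}(S)$ is the set of elements of $S$ having an immediate successor in $S$; both carry the induced order. $\mathrm{Spec}(O_v)$ is the set of prime ideals of $O_v$ ordered by inclusion. A valuation domain with value group $\Gamma$ is $O_v=\{x\in F\mid v(x)\ge 0\}$ for a surjective valuation $v:F\to\Gamma\cup\{\infty\}$ on a field $F$, i.e. $v(x)=\infty$ iff $x=0$, $v(xy)=v(x)+v(y)$, and $v(x+y)\ge\min\{v(x),v(y)\}$. *)

theory Defs
  imports "HOL-Algebra.Ideal" "HOL-Library.Extended"
begin

section \<open>Functions with well ordered support\<close>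

definition supp :: "('t \<Rightarrow> 'g::zero) \<Rightarrow> 't set" where
  "supp f = {t. f t \<noteq> 0}"

definition well_ordered_subset :: "'t::linorder set \<Rightarrow> bool" where
  "well_ordered_subset S \<longleftrightarrow> well_order_on S {(x, y). x \<in> S \<and> y \<in> S \<and> x \<le> y}"

lemma well_ordered_subset_iff:
  fixes S :: "'t::linorder set"
  shows "well_ordered_subset S \<longleftrightarrow> (\<forall>A\<subseteq>S. A \<noteq> {} \<longrightarrow> (\<exists>m\<in>A. \<forall>a\<in>A. m \<le> a))"
proof -
  let ?r = "{(x, y). x \<in> S \<and> y \<in> S \<and> x \<le> y}"
  have lin: "linear_order_on S ?r"
    by (auto simp: linear_order_on_def partial_order_on_def preorder_on_def refl_on_def
        trans_def antisym_def total_on_def)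
  have "wf (?r - Id) \<longleftrightarrow> (\<forall>A\<subseteq>S. A \<noteq> {} \<longrightarrow> (\<exists>m\<in>A. \<forall>a\<in>A. m \<le> a))"
  proof
    assume wf: "wf (?r - Id)"
    show "\<forall>A\<subseteq>S. A \<noteq> {} \<longrightarrow> (\<exists>m\<in>A. \<forall>a\<in>A. m \<le> a)"
    proof (intro allI impI)
      fix A assume A: "A \<subseteq> S" "A \<noteq> {}"
      then obtain x where "x \<in> A" by blast
      from wfE_min[OF wf this] obtain m where
        m: "m \<in> A" "\<And>y. (y, m) \<in> ?r - Id \<Longrightarrow> y \<notin> A" by blast
      have "m \<le> a" if "a \<in> A" for a
        using m(2)[of a] that m(1) A(1) by fastforce
      with m(1) show "\<exists>m\<in>A. \<forall>a\<in>A. m \<le> a" by blast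
    qed
  next
    assume *: "\<forall>A\<subseteq>S. A \<noteq> {} \<longrightarrow> (\<exists>m\<in>A. \<forall>a\<in>A. m \<le> a)"
    show "wf (?r - Id)"
    proof (rule wfI_min)
      fix x :: 't and Q assume x: "x \<in> Q"
      show "\<exists>z\<in>Q. \<forall>y. (y, z) \<in> ?r - Id \<longrightarrow> y \<notin> Q"
      proof (cases "Q \<inter> S = {}")
        case True
        with x show ?thesis by blast
      next
        case False
        with * obtain m where "m \<in> Q \<inter> S" "\<forall>a\<in>Q \<inter> S. m \<le> a"
          by (meson inf_le2)
        then show ?thesis by (intro bexI[of _ m]) force+
      qed
    qed
  qed
  with lin show ?thesis
    by (simp add: well_ordered_subset_def well_order_on_def)
qed

lemma well_ordered_subset_mono:
  "well_ordered_subset S \<Longrightarrow> S' \<subseteq> S \<Longrightarrow> well_ordered_subset S'"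
  unfolding well_ordered_subset_iff by (meson order_trans)

lemma well_ordered_subset_Un:
  assumes "well_ordered_subset S" "well_ordered_subset S'"
  shows "well_ordered_subset (S \<union> S')"
  unfolding well_ordered_subset_iff
proof (intro allI impI)
  fix A assume A: "A \<subseteq> S \<union> S'" "A \<noteq> {}"
  show "\<exists>m\<in>A. \<forall>a\<in>A. m \<le> a"
  proof (cases "A \<inter> S = {} \<or> A \<inter> S' = {}")
    case True
    with A have "A \<subseteq> S \<or> A \<subseteq> S'" by blast
    with A(2) assms show ?thesis unfolding well_ordered_subset_iff by blast
  next
    case False
    have "\<exists>m\<in>A \<inter> S. \<forall>a\<in>A \<inter> S. m \<le> a" "\<exists>m\<in>A \<inter> S'. \<forall>a\<in>A \<inter> S'. m \<le> a"
      using assms False unfolding well_ordered_subset_iff by (meson inf_le2)+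
    then obtain m m' where m: "m \<in> A \<inter> S" "\<forall>a\<in>A \<inter> S. m \<le> a"
      and m': "m' \<in> A \<inter> S'" "\<forall>a\<in>A \<inter> S'. m' \<le> a" by blast
    have "min m m' \<in> A" using m m' by (auto simp: min_def)
    moreover have "min m m' \<le> a" if "a \<in> A" for a
      using that A(1) m(2) m'(2) by (auto simp: min_le_iff_disj)
    ultimately show ?thesis by blast
  qed
qed

text \<open>\<open>('t, 'g) lexfun\<close> is the group \<open>\<Gamma>\<close> itself, rather than a carrier set inside \<open>'t \<Rightarrow> 'g\<close>,
  so that the notions for ordered groups below apply alike to \<open>'g\<close> and to \<open>\<Gamma>\<close>.\<close>

typedef (overloaded) ('t, 'g) lexfun =
  "{f :: 't::linorder \<Rightarrow> 'g::linordered_ab_group_add. well_ordered_subset (supp f)}"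
  morphisms lexfun_apply Lexfun
proof
  show "(\<lambda>_. 0) \<in> {f :: 't \<Rightarrow> 'g. well_ordered_subset (supp f)}"
    by (simp add: supp_def well_ordered_subset_iff)
qed

lemma lexfun_eqI: "(\<And>t. lexfun_apply f t = lexfun_apply g t) \<Longrightarrow> f = g"
  by (metis ext lexfun_apply_inject)

lemma well_ordered_supp: "well_ordered_subset (supp (lexfun_apply f))"
  using lexfun_apply[of f] by simp

instantiation lexfun :: (linorder, linordered_ab_group_add) ab_group_add
begin

definition "0 = Lexfun (\<lambda>_. 0)"
definition "f + g = Lexfun (\<lambda>t. lexfun_apply f t + lexfun_apply g t)"
definition "- f = Lexfun (\<lambda>t. - lexfun_apply f t)"
definition "f - g = Lexfun (\<lambda>t. lexfun_apply f t - lexfun_apply g t)"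

lemma lexfun_apply_zero [simp]: "lexfun_apply 0 t = 0"
  by (subst zero_lexfun_def, subst Lexfun_inverse)
    (simp_all add: supp_def well_ordered_subset_iff)

lemma lexfun_apply_uminus [simp]: "lexfun_apply (- f) t = - lexfun_apply f t"
proof -
  have "well_ordered_subset (supp (\<lambda>t. - lexfun_apply f t))"
    using well_ordered_supp[of f] by (simp add: supp_def)
  then show ?thesis by (simp add: uminus_lexfun_def Lexfun_inverse)
qed

lemma lexfun_apply_add [simp]: "lexfun_apply (f + g) t = lexfun_apply f t + lexfun_apply g t"
proof -
  have "well_ordered_subset (supp (\<lambda>t. lexfun_apply f t + lexfun_apply g t))"
    by (rule well_ordered_subset_mono[OF well_ordered_subset_Un[OF
            well_ordered_supp[of f] well_ordered_supp[of g]]]) (auto simp: supp_def)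
  then show ?thesis by (simp add: plus_lexfun_def Lexfun_inverse)
qed

lemma lexfun_apply_diff [simp]: "lexfun_apply (f - g) t = lexfun_apply f t - lexfun_apply g t"
proof -
  have "well_ordered_subset (supp (\<lambda>t. lexfun_apply f t - lexfun_apply g t))"
    by (rule well_ordered_subset_mono[OF well_ordered_subset_Un[OF
            well_ordered_supp[of f] well_ordered_supp[of g]]]) (auto simp: supp_def)
  then show ?thesis by (simp add: minus_lexfun_def Lexfun_inverse)
qed

instance
  by standard (auto intro!: lexfun_eqI simp: algebra_simps)

end

instantiation lexfun :: (linorder, linordered_ab_group_add) linorder
begin

definition less_eq_lexfun :: "('a, 'b) lexfun \<Rightarrow> ('a, 'b) lexfun \<Rightarrow> bool" where
  "less_eq_lexfun f g \<longleftrightarrow> f = g \<or>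
     (\<exists>t \<in> supp (lexfun_apply f) \<union> supp (lexfun_apply g).
        lexfun_apply f t \<noteq> lexfun_apply g t \<and>
        (\<forall>s \<in> supp (lexfun_apply f) \<union> supp (lexfun_apply g).
           lexfun_apply f s \<noteq> lexfun_apply g s \<longrightarrow> t \<le> s) \<and>
        lexfun_apply f t < lexfun_apply g t)"

definition less_lexfun :: "('a, 'b) lexfun \<Rightarrow> ('a, 'b) lexfun \<Rightarrow> bool" where
  "less_lexfun f g \<longleftrightarrow> f \<le> g \<and> f \<noteq> g"

lemma less_eq_lexfun_iff:
  "f \<le> g \<longleftrightarrow> f = g \<or>
     (\<exists>t. lexfun_apply f t < lexfun_apply g t \<and> (\<forall>s<t. lexfun_apply f s = lexfun_apply g s))"
  (is "?L \<longleftrightarrow> ?R")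
proof
  assume ?L
  then consider "f = g" | t where
    "\<forall>s \<in> supp (lexfun_apply f) \<union> supp (lexfun_apply g).
       lexfun_apply f s \<noteq> lexfun_apply g s \<longrightarrow> t \<le> s"
    "lexfun_apply f t < lexfun_apply g t"
    unfolding less_eq_lexfun_def by blast
  then show ?R
  proof cases
    case 2
    have "lexfun_apply f s = lexfun_apply g s" if "s < t" for s
      using 2(1) that by (force simp: supp_def)
    with 2(2) show ?thesis by blast
  qed simp
next
  assume ?R
  then consider "f = g" | t where "lexfun_apply f t < lexfun_apply g t"
    "\<forall>s<t. lexfun_apply f s = lexfun_apply g s" by blast
  then show ?L
  proof cases
    case 2
    then show ?thesis unfolding less_eq_lexfun_def
      by (intro disjI2 bexI[of _ t]) (auto simp: supp_def not_le[symmetric])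
  qed (simp add: less_eq_lexfun_def)
qed

lemma lexfun_first_difference:
  assumes "f \<noteq> g"
  obtains t where "lexfun_apply f t \<noteq> lexfun_apply g t"
    "\<forall>s<t. lexfun_apply f s = lexfun_apply g s"
proof -
  let ?D = "{t. lexfun_apply f t \<noteq> lexfun_apply g t}"
  have "?D \<noteq> {}" using assms lexfun_eqI[of f g] by blast
  moreover have "?D \<subseteq> supp (lexfun_apply f) \<union> supp (lexfun_apply g)" by (auto simp: supp_def)
  ultimately obtain m where "m \<in> ?D" "\<forall>a\<in>?D. m \<le> a"
    using well_ordered_subset_Un[OF well_ordered_supp[of f] well_ordered_supp[of g]]
    unfolding well_ordered_subset_iff by meson
  then show thesis using that[of m] by (auto simp: not_le[symmetric])
qed

instance
proof
  fix f g h :: "('a, 'b) lexfun"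
  have antisym: "f = g" if "f \<le> g" "g \<le> f" for f g :: "('a, 'b) lexfun"
  proof (rule ccontr)
    assume "f \<noteq> g"
    with that obtain t u where
      "lexfun_apply f t < lexfun_apply g t" "\<forall>s<t. lexfun_apply f s = lexfun_apply g s"
      "lexfun_apply g u < lexfun_apply f u" "\<forall>s<u. lexfun_apply g s = lexfun_apply f s"
      unfolding less_eq_lexfun_iff by metis
    then show False by (cases t u rule: linorder_cases) auto
  qed
  show "f = g" if "f \<le> g" "g \<le> f" using that by (rule antisym)
  show "(f < g) = (f \<le> g \<and> \<not> g \<le> f)"
    using antisym[of f g] by (auto simp: less_lexfun_def)
  show "f \<le> f" by (simp add: less_eq_lexfun_iff)
  show "f \<le> h" if fg: "f \<le> g" and gh: "g \<le> h"
  proof (cases "f = g \<or> g = h")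
    case True
    with that show ?thesis by blast
  next
    case False
    with fg gh obtain t u where
      *: "lexfun_apply f t < lexfun_apply g t" "\<forall>s<t. lexfun_apply f s = lexfun_apply g s"
      "lexfun_apply g u < lexfun_apply h u" "\<forall>s<u. lexfun_apply g s = lexfun_apply h s"
      unfolding less_eq_lexfun_iff by metis
    have "lexfun_apply f (min t u) < lexfun_apply h (min t u)"
      using * by (cases t u rule: linorder_cases) (auto simp: min_def)
    moreover have "\<forall>s<min t u. lexfun_apply f s = lexfun_apply h s"
      using * by auto
    ultimately show ?thesis unfolding less_eq_lexfun_iff by blast
  qed
  show "f \<le> g \<or> g \<le> f"
  proof (cases "f = g")
    case False
    then obtain t where "lexfun_apply f t \<noteq> lexfun_apply g t"
      "\<forall>s<t. lexfun_apply f s = lexfun_apply g s" by (rule lexfun_first_difference)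
    then show ?thesis unfolding less_eq_lexfun_iff by (metis linorder_neqE)
  qed (simp add: less_eq_lexfun_iff)
qed

end

instance lexfun :: (linorder, linordered_ab_group_add) linordered_ab_group_add
proof
  fix f g h :: "('a, 'b) lexfun"
  show "h + f \<le> h + g" if "f \<le> g"
    using that unfolding less_eq_lexfun_iff by auto
qed

definition H_sub :: "'t \<Rightarrow> ('t::linorder, 'g::linordered_ab_group_add) lexfun set" where
  "H_sub t = {f. \<forall>s<t. lexfun_apply f s = 0}"

section \<open>Isolated subgroups and rank one\<close>

definition isolated_subgroup :: "'a::linordered_ab_group_add set \<Rightarrow> bool" where
  "isolated_subgroup H \<longleftrightarrow>
     0 \<in> H \<and> (\<forall>x\<in>H. \<forall>y\<in>H. x + y \<in> H) \<and> (\<forall>x\<in>H. - x \<in> H) \<and>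
     (\<forall>h\<in>H. 0 \<le> h \<longrightarrow> (\<forall>g. 0 \<le> g \<and> g \<le> h \<longrightarrow> g \<in> H))"

definition isolated :: "'a::linordered_ab_group_add set set" where
  "isolated = {H. isolated_subgroup H}"

definition rank_one :: "'a::linordered_ab_group_add itself \<Rightarrow> bool" where
  "rank_one _ \<longleftrightarrow> (\<exists>x::'a. x \<noteq> 0) \<and> (isolated :: 'a set set) = {{0}, UNIV}"

section \<open>Immediate neighbors\<close>

definition immediate_pred :: "'a::order set \<Rightarrow> 'a \<Rightarrow> 'a \<Rightarrow> bool" where
  "immediate_pred S a b \<longleftrightarrow> a \<in> S \<and> b \<in> S \<and> a < b \<and> \<not> (\<exists>c\<in>S. a < c \<and> c < b)"

text \<open>\<open>IS\<close> collects the immediate successors (the elements having an immediate predecessor),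
  \<open>IP\<close> the immediate predecessors.\<close>

definition IS :: "'a::order set \<Rightarrow> 'a set" where
  "IS S = {b \<in> S. \<exists>a\<in>S. immediate_pred S a b}"

definition IP :: "'a::order set \<Rightarrow> 'a set" where
  "IP S = {a \<in> S. \<exists>b\<in>S. immediate_pred S a b}"

definition order_isomorphism :: "('a::order \<Rightarrow> 'b::order) \<Rightarrow> 'a set \<Rightarrow> 'b set \<Rightarrow> bool" where
  "order_isomorphism f A B \<longleftrightarrow>
     bij_betw f A B \<and> (\<forall>x\<in>A. \<forall>y\<in>A. x \<le> y \<longleftrightarrow> f x \<le> f y)"

section \<open>Valuations and their valuation rings\<close>

text \<open>The value \<open>\<infinity>\<close> is \<open>Pinf\<close>; the bottom element \<open>Minf\<close> of \<^typ>\<open>'a extended\<close> is never taken,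
  by the surjectivity condition.\<close>

locale surjective_valuation = field F
  for F :: "('f, 'm) ring_scheme" (structure) +
  fixes v :: "'f \<Rightarrow> 'a::linordered_ab_group_add extended"
  assumes surj: "v ` carrier F = range Fin \<union> {\<infinity>}"
    and infinity_iff: "x \<in> carrier F \<Longrightarrow> v x = \<infinity> \<longleftrightarrow> x = \<zero>"
    and mult: "x \<in> carrier F \<Longrightarrow> y \<in> carrier F \<Longrightarrow> v (x \<otimes> y) = v x + v y"
    and add: "x \<in> carrier F \<Longrightarrow> y \<in> carrier F \<Longrightarrow> min (v x) (v y) \<le> v (x \<oplus> y)"

definition valuation_domain ::
  "('f, 'm) ring_scheme \<Rightarrow> ('f \<Rightarrow> 'a::linordered_ab_group_add extended) \<Rightarrow> ('f, 'm) ring_scheme"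
  where "valuation_domain F v = F\<lparr>carrier := {x \<in> carrier F. 0 \<le> v x}\<rparr>"

definition Spec :: "('f, 'm) ring_scheme \<Rightarrow> 'f set set" where
  "Spec R = {P. primeideal P R}"

end

theory Submission
  imports Defs "HOL-Algebra.Subrings"
begin

text \<open>Let \<open>C\<close> be an isolated subgroup containing some \<open>f\<close> with first nonzero coordinate \<open>t\<close>.
  The values at \<open>t\<close> of the elements of \<open>C \<inter> H\<^sub>t\<close> form a nonzero isolated subgroup of \<open>G\<close>, hence
  all of \<open>G\<close> since \<open>G\<close> has rank one; so \<open>C\<close> has elements of \<open>H\<^sub>t\<close> with arbitrarily large value at \<open>t\<close>,
  and \<open>H\<^sub>t \<subseteq> C\<close>. Thus \<open>H\<^sub>t\<close> is the immediate successor of \<open>{f. f s = 0 for all s \<le> t}\<close>.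
  Conversely, if \<open>A\<close> is the immediate predecessor of \<open>H\<close>, then taking \<open>f \<in> H - A\<close> with first nonzero
  coordinate \<open>t\<close> gives \<open>A \<subset> H\<^sub>t \<subseteq> H\<close>, so \<open>H = H\<^sub>t\<close>.

  The statements on the spectrum follow by composing with the order reversing bijection between
  isolated subgroups and prime ideals, which exchanges \<open>IS\<close> and \<open>IP\<close>, and, for chains, with the
  isomorphism sending an element of \<open>IP\<close> to its immediate successor.\<close>

section \<open>Immediate neighbors in chains\<close>

text \<open>If either inequality held without the other, comparability would put \<open>a\<close>
  strictly between \<open>c\<close> and \<open>d\<close>, or \<open>d\<close> strictly between
  \<open>a\<close> and \<open>b\<close>.\<close>

lemma chain_immediate_succ_le_iff:
  fixes S :: "'a::order set"
  assumes chain: "\<And>x y. x \<in> S \<Longrightarrow> y \<in> S \<Longrightarrow> x \<le> y \<or> y \<le> x"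
    and ab: "immediate_pred S a b" and cd: "immediate_pred S c d"
  shows "b \<le> d \<longleftrightarrow> a \<le> c"
proof -
  have S: "a \<in> S" "b \<in> S" "c \<in> S" "d \<in> S" and lt: "a < b" "c < d"
    using ab cd by (auto simp: immediate_pred_def)
  have gap: "\<not> (x < d \<and> c < x)" "\<not> (x < b \<and> a < x)" if "x \<in> S" for x
    using ab cd that by (auto simp: immediate_pred_def)
  show ?thesis
  proof
    assume "b \<le> d"
    then have "a < d" using lt by order
    show "a \<le> c"
    proof (rule ccontr)
      assume "\<not> a \<le> c"
      then have "c < a" using chain[of a c] S by (auto simp: less_le_not_le)
      with \<open>a < d\<close> gap(1)[of a] S show False by blast
    qed
  next
    assume "a \<le> c"
    show "b \<le> d"
    proof (rule ccontr)
      assume "\<not> b \<le> d"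
      then have "d < b" using chain[of b d] S by (auto simp: less_le_not_le)
      moreover have "a < d" using \<open>a \<le> c\<close> lt by order
      ultimately show False using gap(2)[of d] S by blast
    qed
  qed
qed

lemma chain_IP_isomorphic_IS:
  fixes S :: "'a::order set"
  assumes chain: "\<And>x y. x \<in> S \<Longrightarrow> y \<in> S \<Longrightarrow> x \<le> y \<or> y \<le> x"
  obtains f where "order_isomorphism f (IP S) (IS S)"
proof -
  have "\<forall>a\<in>IP S. \<exists>b. immediate_pred S a b" by (auto simp: IP_def)
  then obtain f where f: "\<And>a. a \<in> IP S \<Longrightarrow> immediate_pred S a (f a)" by metis
  have iff: "a \<le> c \<longleftrightarrow> f a \<le> f c" if "a \<in> IP S" "c \<in> IP S" for a c
    using chain_immediate_succ_le_iff[OF chain f[OF that(1)] f[OF that(2)]] by simp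
  have "inj_on f (IP S)"
    by (rule inj_onI) (metis iff order.antisym order.refl)
  moreover have "f ` IP S = IS S"
  proof
    show "f ` IP S \<subseteq> IS S"
      using f by (auto simp: IS_def immediate_pred_def)
  next
    show "IS S \<subseteq> f ` IP S"
    proof
      fix b assume "b \<in> IS S"
      then obtain a where ab: "immediate_pred S a b" by (auto simp: IS_def)
      then have a: "a \<in> IP S" by (auto simp: IP_def immediate_pred_def)
      \<comment> \<open>Uniqueness of immediate successors in a chain: the comparison lemma with the
        same predecessor \<open>a\<close> on both sides gives both inequalities.\<close>
      have "f a = b"
        using chain_immediate_succ_le_iff[OF chain f[OF a] ab]
          chain_immediate_succ_le_iff[OF chain ab f[OF a]] by (simp add: order.antisym)
      with a show "b \<in> f ` IP S" by blast
    qed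
  qed
  ultimately show thesis
    using that[of f] iff by (auto simp: order_isomorphism_def bij_betw_def)
qed

lemma order_isomorphism_trans:
  assumes "order_isomorphism f A B" "order_isomorphism g B C"
  shows "order_isomorphism (g \<circ> f) A C"
proof -
  have "bij_betw (g \<circ> f) A C"
    using assms by (auto simp: order_isomorphism_def intro: bij_betw_trans)
  moreover have "f x \<in> B" if "x \<in> A" for x
    using assms(1) that by (auto simp: order_isomorphism_def bij_betw_def)
  ultimately show ?thesis
    using assms by (simp add: order_isomorphism_def)
qed

text \<open>An order reversing bijection keeps gaps but swaps their two ends, so upper ends become
  lower ends.\<close>

lemma bij_betw_IS_IP:
  fixes f :: "'a::order \<Rightarrow> 'b::order"
  assumes bij: "bij_betw f A B"
    and anti: "\<And>x y. x \<in> A \<Longrightarrow> y \<in> A \<Longrightarrow> x \<le> y \<longleftrightarrow> f y \<le> f x"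
  shows "bij_betw f (IS A) (IP B)"
proof -
  have B: "B = f ` A" and inj: "inj_on f A" using bij by (auto simp: bij_betw_def)
  have less: "x < y \<longleftrightarrow> f y < f x" if "x \<in> A" "y \<in> A" for x y
    using anti[OF that] anti[OF that(2,1)] by (simp add: less_le_not_le)
  have "immediate_pred A x y \<longleftrightarrow> immediate_pred B (f y) (f x)" if "x \<in> A" "y \<in> A" for x y
    using that by (auto simp: immediate_pred_def B less)
  then have "f ` IS A = IP B" unfolding IS_def IP_def B by auto
  moreover have "inj_on f (IS A)"
    using inj by (rule inj_on_subset) (auto simp: IS_def)
  ultimately show ?thesis by (simp add: bij_betw_def)
qed

section \<open>Isolated subgroups\<close>

text \<open>The class \<open>linordered_ab_group_add\<close> has no absolute value; \<open>max a (- a)\<close> takes its place.\<close>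

lemma max_uminus_nonneg:
  fixes a :: "'a::linordered_ab_group_add"
  shows "0 \<le> max a (- a)"
  by (cases "0 \<le> a") (auto simp: le_max_iff_disj)

lemma isolated_subgroupD:
  assumes "isolated_subgroup H"
  shows "0 \<in> H" "x \<in> H \<Longrightarrow> y \<in> H \<Longrightarrow> x + y \<in> H" "x \<in> H \<Longrightarrow> - x \<in> H"
    "h \<in> H \<Longrightarrow> 0 \<le> g \<Longrightarrow> g \<le> h \<Longrightarrow> g \<in> H"
proof -
  show "g \<in> H" if "h \<in> H" "0 \<le> g" "g \<le> h"
    using assms that order_trans[OF that(2,3)] by (simp add: isolated_subgroup_def)
qed (use assms in \<open>simp_all add: isolated_subgroup_def\<close>)

lemma isolated_subgroup_max_uminus_iff:
  assumes "isolated_subgroup H"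
  shows "max a (- a) \<in> H \<longleftrightarrow> a \<in> H"
  using isolated_subgroupD(3)[OF assms, of a] isolated_subgroupD(3)[OF assms, of "- a"]
  by (auto simp: max_def)

text \<open>Isolation speaks of nonnegative elements only; passing to \<open>max g (- g)\<close>
  extends it to the whole interval from \<open>- h\<close> to \<open>h\<close>.\<close>

lemma isolated_subgroup_between:
  assumes H: "isolated_subgroup H" and h: "h \<in> H" and g: "- h \<le> g" "g \<le> h"
  shows "g \<in> H"
proof -
  have "max g (- g) \<le> h" using g by (simp add: minus_le_iff)
  then have "max g (- g) \<in> H"
    using isolated_subgroupD(4)[OF H h max_uminus_nonneg] by blast
  then show ?thesis using isolated_subgroup_max_uminus_iff[OF H] by blast
qed

text \<open>Given \<open>a\<close> in \<open>A\<close> only and \<open>b\<close> in \<open>B\<close>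
  only, the smaller of the two absolute values would be forced by isolation into the subgroup that
  omits it.\<close>

lemma isolated_subgroups_chain:
  assumes A: "isolated_subgroup A" and B: "isolated_subgroup B"
  shows "A \<subseteq> B \<or> B \<subseteq> A"
proof (rule ccontr)
  assume "\<not> ?thesis"
  then obtain a b where a: "a \<in> A" "a \<notin> B" and b: "b \<in> B" "b \<notin> A" by blast
  let ?a = "max a (- a)" and ?b = "max b (- b)"
  have "?a \<in> A" "?a \<notin> B" "?b \<in> B" "?b \<notin> A"
    using a b isolated_subgroup_max_uminus_iff[OF A] isolated_subgroup_max_uminus_iff[OF B] by auto
  then have "\<not> ?b \<le> ?a" "\<not> ?a \<le> ?b"
    using isolated_subgroupD(4)[OF A _ max_uminus_nonneg, of ?a b]
      isolated_subgroupD(4)[OF B _ max_uminus_nonneg, of ?b a] by blast+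
  then show False using linear[of ?a ?b] by blast
qed

section \<open>The isolated subgroups having an immediate predecessor\<close>

definition lex_single :: "'t \<Rightarrow> 'g \<Rightarrow> ('t::linorder, 'g::linordered_ab_group_add) lexfun" where
  "lex_single t a = Lexfun (\<lambda>s. if s = t then a else 0)"

lemma lexfun_apply_lex_single [simp]:
  "lexfun_apply (lex_single t a) s = (if s = t then a else 0)"
proof -
  have "supp (\<lambda>s. if s = t then a else 0) \<subseteq> {t}" by (auto simp: supp_def)
  then have "well_ordered_subset (supp (\<lambda>s. if s = t then a else 0))"
    unfolding well_ordered_subset_iff by fast
  then show ?thesis by (simp add: lex_single_def Lexfun_inverse)
qed

lemma lexfun_leading_term:
  assumes "f \<noteq> 0"
  obtains t where "f \<in> H_sub t" "lexfun_apply f t \<noteq> 0"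
proof -
  from assms obtain t where "lexfun_apply f t \<noteq> lexfun_apply 0 t"
    "\<forall>s<t. lexfun_apply f s = lexfun_apply 0 s" by (rule lexfun_first_difference)
  then show thesis using that[of t] by (simp add: H_sub_def)
qed

lemma H_sub_leI:
  assumes "f \<in> H_sub t" "g \<in> H_sub t" "lexfun_apply f t < lexfun_apply g t"
  shows "f \<le> g"
proof -
  have "\<forall>s<t. lexfun_apply f s = lexfun_apply g s" using assms(1,2) by (simp add: H_sub_def)
  with assms(3) show ?thesis unfolding less_eq_lexfun_iff by blast
qed

text \<open>With \<open>D = {..<t}\<close> this yields \<open>H_sub t\<close>, with
  \<open>D = {..t}\<close> its immediate predecessor. In the nontrivial case
  \<open>0 < g < h\<close>, the first nonzero coordinate of \<open>g\<close> must lie beyond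
  \<open>D\<close>.\<close>

lemma isolated_subgroup_vanishing:
  fixes D :: "'t::linorder set"
  assumes D: "\<And>s t. t \<in> D \<Longrightarrow> s < t \<Longrightarrow> s \<in> D"
  shows "isolated_subgroup
    {f :: ('t, 'g::linordered_ab_group_add) lexfun. \<forall>s\<in>D. lexfun_apply f s = 0}"
proof -
  let ?A = "{f :: ('t, 'g) lexfun. \<forall>s\<in>D. lexfun_apply f s = 0}"
  have "g \<in> ?A" if h: "h \<in> ?A" and g: "0 \<le> g" "g \<le> h" for g h
  proof -
    consider "g = 0" | "g = h" | t u where
      "lexfun_apply 0 t < lexfun_apply g t" "\<forall>s<t. lexfun_apply 0 s = lexfun_apply g s"
      "lexfun_apply g u < lexfun_apply h u" "\<forall>s<u. lexfun_apply g s = lexfun_apply h s"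
      using g unfolding less_eq_lexfun_iff[of 0 g] less_eq_lexfun_iff[of g h] by metis
    then show ?thesis
    proof cases
      case 3
      have g0: "lexfun_apply g s = 0" if "s < t" for s using 3(2) that by simp
      have h0: "lexfun_apply h s = 0" if "s \<in> D" for s using h that by simp
      have "t \<notin> D"
      proof
        assume "t \<in> D"
        then have ht: "lexfun_apply h t = 0" by (rule h0)
        \<comment> \<open>\<open>h\<close> vanishes at \<open>t\<close> while \<open>g\<close> is
          positive there, so \<open>g\<close> and \<open>h\<close> differ by \<open>t\<close> at the
          latest. At \<open>u\<close> the value of \<open>h\<close> is then zero, and
          \<open>g\<close> would be negative at a coordinate where it is zero or positive.\<close>
        have "u \<le> t"
        proof (rule leI, rule notI)
          assume "t < u"
          then have "lexfun_apply g t = 0" using 3(4) ht by simp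
          with 3(1) show False by simp
        qed
        then have "u \<in> D" using D[OF \<open>t \<in> D\<close>, of u] \<open>t \<in> D\<close> by (cases "u = t") simp_all
        then have "lexfun_apply g u < 0" using h0[of u] 3(3) by simp
        moreover have "0 \<le> lexfun_apply g u"
          using \<open>u \<le> t\<close> g0[of u] 3(1) by (cases "u = t") simp_all
        ultimately show False by simp
      qed
      have "s < t" if "s \<in> D" for s
      proof (rule ccontr)
        assume "\<not> s < t"
        then have "t < s \<or> t = s" by auto
        then show False using D[OF that, of t] that \<open>t \<notin> D\<close> by blast
      qed
      then show ?thesis using g0 by simp
    qed (use h in simp_all)
  qed
  then have "\<forall>h\<in>?A. 0 \<le> h \<longrightarrow> (\<forall>g. 0 \<le> g \<and> g \<le> h \<longrightarrow> g \<in> ?A)"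
    by (intro ballI allI impI) (elim conjE)
  moreover have "0 \<in> ?A" "\<forall>x\<in>?A. \<forall>y\<in>?A. x + y \<in> ?A" "\<forall>x\<in>?A. - x \<in> ?A" by simp_all
  ultimately show ?thesis unfolding isolated_subgroup_def by (intro conjI)
qed

lemma isolated_subgroup_H_sub:
  "isolated_subgroup (H_sub t :: ('t::linorder, 'g::linordered_ab_group_add) lexfun set)"
proof -
  have "(H_sub t :: ('t, 'g) lexfun set) = {f. \<forall>s\<in>{..<t}. lexfun_apply f s = 0}" by (auto simp: H_sub_def)
  moreover have "isolated_subgroup {f :: ('t, 'g) lexfun. \<forall>s\<in>{..<t}. lexfun_apply f s = 0}"
    by (rule isolated_subgroup_vanishing) auto
  ultimately show ?thesis by (simp only:)
qed

text \<open>This is where the absence of isolated subgroups of \<open>G\<close> strictly between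
  \<open>{0}\<close> and \<open>G\<close> enters.\<close>

lemma H_sub_subset_isolated:
  fixes C :: "('t::linorder, 'g::linordered_ab_group_add) lexfun set"
  assumes rank: "rank_one TYPE('g)" and C: "isolated_subgroup C"
    and f: "f \<in> C" "f \<in> H_sub t" "lexfun_apply f t \<noteq> 0"
  shows "H_sub t \<subseteq> C"
proof
  fix h :: "('t, 'g) lexfun" assume h: "h \<in> H_sub t"
  let ?K = "(\<lambda>g. lexfun_apply g t) ` (C \<inter> H_sub t)"
  note CD = isolated_subgroupD[OF C] and HD = isolated_subgroupD[OF isolated_subgroup_H_sub[of t]]
  have zero: "0 \<in> ?K" by (rule image_eqI[of _ _ 0]) (auto simp: CD(1-3) HD(1-3))
  have "isolated_subgroup ?K"
    unfolding isolated_subgroup_def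
  proof (intro conjI ballI allI impI)
    show "0 \<in> ?K" by (rule zero)
  next
    fix x y assume "x \<in> ?K" "y \<in> ?K"
    then obtain g g' where "g \<in> C \<inter> H_sub t" "g' \<in> C \<inter> H_sub t"
      "x = lexfun_apply g t" "y = lexfun_apply g' t" by blast
    then show "x + y \<in> ?K" by (intro image_eqI[of _ _ "g + g'"]) (auto simp: CD(1-3) HD(1-3))
  next
    fix x assume "x \<in> ?K"
    then obtain g where "g \<in> C \<inter> H_sub t" "x = lexfun_apply g t" by blast
    then show "- x \<in> ?K" by (intro image_eqI[of _ _ "- g"]) (auto simp: CD(1-3) HD(1-3))
  next
    fix x b assume "x \<in> ?K" and b: "0 \<le> b \<and> b \<le> x"
    then obtain g where g: "g \<in> C \<inter> H_sub t" "x = lexfun_apply g t" by blast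
    show "b \<in> ?K"
    proof (cases "b = 0 \<or> b = x")
      case True
      with \<open>x \<in> ?K\<close> zero show ?thesis by blast
    next
      case False
      \<comment> \<open>Since \<open>0 < b < x\<close> strictly, the comparisons of
        \<open>lex_single t b\<close> with \<open>0\<close> and \<open>g\<close> are decided at
        \<open>t\<close>. A tie at \<open>t\<close> would leave them to later coordinates, hence the
        separate endpoint case.\<close>
      have mem: "lex_single t b \<in> H_sub t" by (simp add: H_sub_def)
      have "0 \<le> lex_single t b" "lex_single t b \<le> g"
        using False b g mem by (auto intro!: H_sub_leI[of _ t] simp: HD(1))
      then have "lex_single t b \<in> C" using CD(4) g(1) by blast
      with mem show ?thesis by (intro image_eqI[of _ _ "lex_single t b"]) auto
    qed
  qed
  then have "?K \<in> isolated" by (simp only: isolated_def mem_Collect_eq)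
  moreover have "(isolated :: 'g set set) = {{0}, UNIV}" using rank by (simp add: rank_one_def)
  ultimately have "?K \<in> {{0}, UNIV}" by (simp only:)
  moreover have "lexfun_apply f t \<in> ?K" using f by blast
  ultimately have K: "?K = UNIV" using f(3) by (metis insertE singletonD)
  define a c where "a = lexfun_apply h t" and "c = lexfun_apply f t"
  \<comment> \<open>The positive summand \<open>max c (- c)\<close> makes the value of
    \<open>g\<close> at \<open>t\<close> strictly exceed both \<open>a\<close> and
    \<open>- a\<close>, so \<open>- g \<le> h \<le> g\<close> is decided at
    \<open>t\<close>.\<close>
  have "max a (- a) + max c (- c) \<in> ?K" unfolding K by (rule UNIV_I)
  then obtain g where g: "g \<in> C" "g \<in> H_sub t"
    "lexfun_apply g t = max a (- a) + max c (- c)" by auto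
  have "0 < max c (- c)" using f(3) by (auto simp: c_def less_max_iff_disj)
  then have "max a (- a) < lexfun_apply g t" by (simp add: g(3))
  then have "a < lexfun_apply g t" "- a < lexfun_apply g t" by simp_all
  then have "- g \<le> h" "h \<le> g"
    using h g(2) by (auto intro!: H_sub_leI[of _ t] simp: HD(3) a_def minus_less_iff)
  then show "h \<in> C" using isolated_subgroup_between[OF C g(1)] by blast
qed

text \<open>The element \<open>lex_single t c\<close> tells the subgroups apart; over the zero group
  they would all coincide.\<close>

lemma H_sub_subset_iff:
  assumes "(c :: 'g::linordered_ab_group_add) \<noteq> 0"
  shows "(H_sub t :: ('t::linorder, 'g) lexfun set) \<subseteq> H_sub s \<longleftrightarrow> s \<le> t"
proof
  assume "(H_sub t :: ('t, 'g) lexfun set) \<subseteq> H_sub s"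
  moreover have "lex_single t c \<in> H_sub t" by (simp add: H_sub_def)
  ultimately have "lex_single t c \<in> H_sub s" by blast
  with assms show "s \<le> t" unfolding H_sub_def by (auto intro: leI)
qed (auto simp: H_sub_def)

lemma H_sub_mem_IS:
  assumes rank: "rank_one TYPE('g::linordered_ab_group_add)"
  shows "(H_sub t :: ('t::linorder, 'g) lexfun set) \<in> IS isolated"
proof -
  obtain c :: 'g where c: "c \<noteq> 0" using rank by (auto simp: rank_one_def)
  let ?A = "{f :: ('t, 'g) lexfun. \<forall>s\<in>{..t}. lexfun_apply f s = 0}"
  have A: "isolated_subgroup ?A" by (rule isolated_subgroup_vanishing) auto
  have "lex_single t c \<in> H_sub t" "lex_single t c \<notin> ?A" using c by (auto simp: H_sub_def)
  moreover have "?A \<subseteq> H_sub t" by (auto simp: H_sub_def)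
  ultimately have less: "?A \<subset> H_sub t" by blast
  have "H_sub t \<subseteq> C" if C: "isolated_subgroup C" "?A \<subset> C" "C \<subset> H_sub t" for C
  proof -
    from C(2) obtain f where f: "f \<in> C" "f \<notin> ?A" by blast
    then have "f \<in> H_sub t" using C(3) by blast
    \<comment> \<open>Inside \<open>H_sub t\<close>, membership in \<open>?A\<close> depends only on
      the value at \<open>t\<close>.\<close>
    moreover have "lexfun_apply f t \<noteq> 0"
    proof
      assume "lexfun_apply f t = 0"
      then have "lexfun_apply f s = 0" if "s \<le> t" for s
        using \<open>f \<in> H_sub t\<close> that by (cases "s = t") (simp_all add: H_sub_def)
      with f(2) show False by simp
    qed
    ultimately show ?thesis by (rule H_sub_subset_isolated[OF rank C(1) f(1)])
  qed
  then have "\<not> (\<exists>C\<in>isolated. ?A \<subset> C \<and> C \<subset> H_sub t)"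
    unfolding isolated_def by blast
  then have "immediate_pred isolated ?A (H_sub t)"
    using A less isolated_subgroup_H_sub[of t] by (simp add: immediate_pred_def isolated_def)
  moreover have "?A \<in> isolated" "H_sub t \<in> isolated"
    using A isolated_subgroup_H_sub[of t] by (simp_all add: isolated_def)
  ultimately show ?thesis unfolding IS_def by blast
qed

lemma IS_isolated_imp_H_sub:
  fixes H :: "('t::linorder, 'g::linordered_ab_group_add) lexfun set"
  assumes rank: "rank_one TYPE('g)" and H: "H \<in> IS isolated"
  obtains t where "H = H_sub t"
proof -
  from H obtain A where A: "isolated_subgroup A" "isolated_subgroup H" "A \<subset> H"
    and gap: "\<And>C. isolated_subgroup C \<Longrightarrow> \<not> (A \<subset> C \<and> C \<subset> H)"
    by (auto simp: IS_def immediate_pred_def isolated_def)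
  then obtain f where f: "f \<in> H" "f \<notin> A" by blast
  then have "f \<noteq> 0" using isolated_subgroupD(1)[OF A(1)] by blast
  then obtain t where t: "f \<in> H_sub t" "lexfun_apply f t \<noteq> 0" by (rule lexfun_leading_term)
  have "H_sub t \<subseteq> H" using rank A(2) f(1) t by (rule H_sub_subset_isolated)
  \<comment> \<open>\<open>f\<close> lies in \<open>H_sub t\<close> but not in \<open>A\<close>, so
    of the two possible inclusions only the strict one from \<open>A\<close> remains.\<close>
  moreover have "A \<subset> H_sub t"
    using isolated_subgroups_chain[OF A(1) isolated_subgroup_H_sub[of t]] f(2) t(1) by blast
  ultimately have "H = H_sub t" using gap[OF isolated_subgroup_H_sub] by blast
  then show thesis by (rule that)
qed

lemma bij_betw_H_sub:
  assumes rank: "rank_one TYPE('g::linordered_ab_group_add)"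
  shows "bij_betw (H_sub :: 't::linorder \<Rightarrow> ('t, 'g) lexfun set) UNIV (IS isolated)"
proof -
  obtain c :: 'g where c: "c \<noteq> 0" using rank by (auto simp: rank_one_def)
  have "inj (H_sub :: 't \<Rightarrow> ('t, 'g) lexfun set)"
    by (rule injI) (simp add: set_eq_subset H_sub_subset_iff[OF c] order.antisym)
  moreover have "range H_sub = IS (isolated :: ('t, 'g) lexfun set set)"
    using H_sub_mem_IS[OF rank] by (blast elim: IS_isolated_imp_H_sub[OF rank])
  ultimately show ?thesis by (simp add: bij_betw_def)
qed

section \<open>Prime ideals of a valuation domain\<close>

text \<open>Additive inverses come from multiplying by \<open>\<ominus> \<one>\<close>.\<close>

lemma (in cring) cring_idealI:
  assumes sub: "I \<subseteq> carrier R" and zero: "\<zero> \<in> I"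
    and add: "\<And>x y. x \<in> I \<Longrightarrow> y \<in> I \<Longrightarrow> x \<oplus> y \<in> I"
    and mult: "\<And>a x. a \<in> carrier R \<Longrightarrow> x \<in> I \<Longrightarrow> a \<otimes> x \<in> I"
  shows "ideal I R"
proof (rule idealI)
  have "\<ominus> x \<in> I" if "x \<in> I" for x
  proof -
    have "\<ominus> \<one> \<otimes> x \<in> I" using that by (intro mult) auto
    moreover have "\<ominus> \<one> \<otimes> x = \<ominus> x" using that sub by (auto simp: l_minus)
    ultimately show ?thesis by simp
  qed
  then show "subgroup I (add_monoid R)"
    using sub zero add by (intro add.subgroupI) (auto simp: a_inv_def)
  fix a x assume "a \<in> I" "x \<in> carrier R"
  then show "x \<otimes> a \<in> I" "a \<otimes> x \<in> I"
    using sub mult[of x a] m_comm[of a x] by auto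
qed (rule ring_axioms)

section \<open>Values, ideals and the order reversing correspondence with isolated subgroups\<close>

context surjective_valuation
begin

text \<open>Surjectivity onto exactly \<open>range Fin \<union> {\<infinity>}\<close> rules out
  \<open>Minf\<close>; only zero takes the value \<open>\<infinity>\<close>.\<close>

lemma finite_value:
  assumes "x \<in> carrier F" "x \<noteq> \<zero>"
  obtains a where "v x = Fin a"
  using assms infinity_iff[of x] surj by blast

lemma value_attained:
  obtains x where "x \<in> carrier F" "v x = Fin a"
proof -
  have "Fin a \<in> v ` carrier F" using surj by blast
  then show thesis using that by (metis imageE)
qed

lemma value_one: "v \<one> = 0"
proof -
  obtain e where e: "v \<one> = Fin e" using finite_value[OF one_closed one_not_zero] .
  moreover have "v \<one> = v \<one> + v \<one>" using mult[of \<one> \<one>] by simp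
  ultimately show ?thesis by (simp add: zero_extended_def)
qed

lemma value_minus_one: "v (\<ominus> \<one>) = 0"
proof -
  have sq: "v (\<ominus> \<one>) + v (\<ominus> \<one>) = 0"
    using mult[of "\<ominus> \<one>" "\<ominus> \<one>"] by (simp add: l_minus value_one)
  have "\<ominus> \<one> \<noteq> \<zero>" using one_not_zero by (metis add.inv_eq_1_iff one_closed)
  then obtain b where b: "v (\<ominus> \<one>) = Fin b" using finite_value[of "\<ominus> \<one>"] by auto
  \<comment> \<open>A totally ordered group has no 2-torsion, so \<open>b + b = 0\<close> forces
    \<open>b = 0\<close>.\<close>
  with sq show ?thesis by (simp add: zero_extended_def)
qed

lemma value_minus:
  assumes "x \<in> carrier F"
  shows "v (\<ominus> x) = v x"
proof -
  have "\<ominus> x = \<ominus> \<one> \<otimes> x" using assms by (simp add: l_minus)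
  then show ?thesis using mult[of "\<ominus> \<one>" x] assms by (simp add: value_minus_one)
qed

lemma subring_valuation: "subring {x \<in> carrier F. 0 \<le> v x} F"
proof (rule subringI)
  fix x y assume xy: "x \<in> {x \<in> carrier F. 0 \<le> v x}" "y \<in> {x \<in> carrier F. 0 \<le> v x}"
  have "0 + 0 \<le> v x + v y" using xy by (intro add_mono) auto
  then show "x \<otimes> y \<in> {x \<in> carrier F. 0 \<le> v x}" using xy mult by simp
  have "0 \<le> min (v x) (v y)" using xy by simp
  also have "\<dots> \<le> v (x \<oplus> y)" using xy add by simp
  finally show "x \<oplus> y \<in> {x \<in> carrier F. 0 \<le> v x}" using xy by simp
qed (auto simp: value_one value_minus)

abbreviation O_v :: "('f, 'm) ring_scheme" where "O_v \<equiv> valuation_domain F v"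

lemma O_v_simps [simp]:
  "x \<in> carrier O_v \<longleftrightarrow> x \<in> carrier F \<and> 0 \<le> v x"
  "mult O_v = mult F" "add O_v = add F" "one O_v = one F" "zero O_v = zero F"
  by (simp_all add: valuation_domain_def)

lemma cring_O_v: "cring O_v"
  unfolding valuation_domain_def
  using subcring_iff[of "{x \<in> carrier F. 0 \<le> v x}"] subcringI'[OF subring_valuation] by auto

text \<open>For nonzero \<open>x\<close> the quotient of \<open>x\<close> by \<open>y\<close> has
  nonnegative value, so \<open>x\<close> is a multiple of \<open>y\<close> in \<open>O_v\<close>.
  Hence membership in an ideal depends only on the value.\<close>

lemma ideal_value_mono:
  assumes P: "ideal P O_v" and y: "y \<in> P" and x: "x \<in> carrier F" and le: "v y \<le> v x"
  shows "x \<in> P"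
proof -
  interpret P: ideal P O_v by (rule P)
  have y': "y \<in> carrier F" "0 \<le> v y" using P.Icarr[OF y] by auto
  show ?thesis
  proof (cases "x = \<zero>")
    case True
    then show ?thesis using additive_subgroup.zero_closed[OF P.is_additive_subgroup] by simp
  next
    case False
    then obtain a where a: "v x = Fin a" using x finite_value by blast
    with le have "y \<noteq> \<zero>" using infinity_iff[of \<zero>] by auto
    then obtain b where b: "v y = Fin b" using y' finite_value by blast
    have "y \<in> Units F" using \<open>y \<noteq> \<zero>\<close> y'(1) field_Units by blast
    define z where "z = x \<otimes> inv y"
    have z: "z \<in> carrier F" "z \<otimes> y = x"
      using x y'(1) \<open>y \<in> Units F\<close> by (simp_all add: z_def m_assoc)
    then have sum: "v x = v z + v y" using mult[of z y] y'(1) by simp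
    have "z \<noteq> \<zero>" using z False y'(1) by auto
    then obtain c where c: "v z = Fin c" using z(1) finite_value by blast
    have "a = c + b" using sum a b c by simp
    with le a b c have "0 \<le> v z" by (simp add: zero_extended_def)
    then show ?thesis using P.I_l_closed[OF y, of z] z by simp
  qed
qed

text \<open>The complement in \<open>O_v\<close> consists of the elements with value in
  \<open>H\<close>. Zero belongs to the set because \<open>\<infinity>\<close> is never in
  \<open>Fin\<close> followed by any group element.\<close>

definition prime_of :: "'a set \<Rightarrow> 'f set" where
  "prime_of H = {x \<in> carrier F. 0 \<le> v x \<and> v x \<notin> Fin ` H}"

text \<open>Isolation makes the set upward closed in values, which gives the ideal laws. Closure of
  \<open>H\<close> under addition gives primality, and \<open>0 \<in> H\<close> keeps
  \<open>\<one>\<close> out.\<close>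

lemma primeideal_prime_of:
  assumes H: "isolated_subgroup H"
  shows "primeideal (prime_of H) O_v"
proof (rule primeidealI[OF _ cring_O_v])
  have up: "y \<in> prime_of H" if "x \<in> prime_of H" "y \<in> carrier F" "v x \<le> v y" for x y
  proof -
    have "v y \<notin> Fin ` H"
    proof
      assume "v y \<in> Fin ` H"
      then obtain h where h: "h \<in> H" "v y = Fin h" by blast
      with that obtain a where a: "v x = Fin a" "0 \<le> a" "a \<le> h" "a \<notin> H"
        by (cases "v x") (auto simp: prime_of_def zero_extended_def)
      then show False using isolated_subgroupD(4)[OF H h(1)] by blast
    qed
    with that show ?thesis by (auto simp: prime_of_def)
  qed
  interpret O: cring O_v by (rule cring_O_v)
  show "ideal (prime_of H) O_v"
  proof (rule O.cring_idealI)
    show "prime_of H \<subseteq> carrier O_v" by (auto simp: prime_of_def)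
    show "\<zero>\<^bsub>O_v\<^esub> \<in> prime_of H"
      using infinity_iff[of \<zero>] by (auto simp: prime_of_def)
    fix x y assume xy: "x \<in> prime_of H" "y \<in> prime_of H"
    then have c: "x \<in> carrier F" "y \<in> carrier F" by (auto simp: prime_of_def)
    have "v x \<le> v (x \<oplus> y) \<or> v y \<le> v (x \<oplus> y)"
      using add[OF c] by (simp add: min_le_iff_disj)
    then show "x \<oplus>\<^bsub>O_v\<^esub> y \<in> prime_of H" using up xy c by auto
  next
    fix a x assume a: "a \<in> carrier O_v" and x: "x \<in> prime_of H"
    then have c: "a \<in> carrier F" "x \<in> carrier F" by (auto simp: prime_of_def)
    have "0 + v x \<le> v a + v x" using a by (intro add_mono) auto
    then show "a \<otimes>\<^bsub>O_v\<^esub> x \<in> prime_of H" using up[OF x] c mult[OF c] by simp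
  qed
  have "\<one> \<notin> prime_of H"
    using isolated_subgroupD(1)[OF H] by (auto simp: prime_of_def value_one zero_extended_def)
  moreover have "\<one> \<in> carrier O_v" by (simp add: value_one)
  ultimately show "carrier O_v \<noteq> prime_of H" by blast
  fix a b assume ab: "a \<in> carrier O_v" "b \<in> carrier O_v" "a \<otimes>\<^bsub>O_v\<^esub> b \<in> prime_of H"
  show "a \<in> prime_of H \<or> b \<in> prime_of H"
  proof (rule ccontr)
    assume "\<not> ?thesis"
    then obtain g h where "g \<in> H" "h \<in> H" "v a = Fin g" "v b = Fin h"
      using ab by (auto simp: prime_of_def)
    then have "v (a \<otimes> b) \<in> Fin ` H"
      using mult[of a b] ab isolated_subgroupD(2)[OF H] by auto
    with ab(3) show False by (simp add: prime_of_def)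
  qed
qed

text \<open>\<open>prime_of\<close> sees only nonnegative elements of \<open>H\<close>, but these
  determine \<open>H\<close>: each \<open>h\<close> is replaced by \<open>max h (- h)\<close>, which
  is the value of some field element.\<close>

lemma prime_of_subset_iff:
  assumes H: "isolated_subgroup H" and H': "isolated_subgroup H'"
  shows "H \<subseteq> H' \<longleftrightarrow> prime_of H' \<subseteq> prime_of H"
proof
  assume sub: "prime_of H' \<subseteq> prime_of H"
  show "H \<subseteq> H'"
  proof
    fix h assume "h \<in> H"
    let ?h = "max h (- h)"
    obtain x where x: "x \<in> carrier F" "v x = Fin ?h" by (rule value_attained)
    have "?h \<in> H" using \<open>h \<in> H\<close> isolated_subgroup_max_uminus_iff[OF H] by blast
    then have "x \<notin> prime_of H" using x(2) unfolding prime_of_def by blast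
    with sub have "x \<notin> prime_of H'" by blast
    then have "?h \<in> H'"
      using x max_uminus_nonneg[of h] unfolding prime_of_def by (auto simp: zero_extended_def)
    then show "h \<in> H'" using isolated_subgroup_max_uminus_iff[OF H'] by blast
  qed
qed (auto simp: prime_of_def)

lemma primeideal_imp_prime_of:
  assumes P: "primeideal P O_v"
  obtains H where "isolated_subgroup H" "P = prime_of H"
proof -
  interpret P: primeideal P O_v by (rule P)
  note mono = ideal_value_mono[OF P.is_ideal]
  have PF: "x \<in> carrier F" "0 \<le> v x" if "x \<in> P" for x using P.Icarr[OF that] by auto
  let ?m = "\<lambda>a. max a (- a)"
  \<comment> \<open>The nonnegative part of \<open>H\<close> is the set of values of
    \<open>O_v\<close> outside \<open>P\<close>; the absolute value makes it symmetric.\<close>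
  define H where "H = {a. Fin (?m a) \<notin> v ` P}"
  have up: "Fin b \<in> v ` P" if "Fin a \<in> v ` P" "a \<le> b" for a b
  proof -
    from that(1) obtain y where y: "y \<in> P" "v y = Fin a" by force
    obtain x where x: "x \<in> carrier F" "v x = Fin b" by (rule value_attained)
    have "x \<in> P" using mono[OF y(1) x(1)] x y that(2) by simp
    with x(2) show ?thesis by force
  qed
  \<comment> \<open>Primality of \<open>P\<close> read off on values. Its contrapositive, with the
    triangle inequality and \<open>up\<close>, makes \<open>H\<close> closed under addition.\<close>
  have plus: "Fin a \<in> v ` P \<or> Fin b \<in> v ` P" if ab: "0 \<le> a" "0 \<le> b" "Fin (a + b) \<in> v ` P" for a b
  proof -
    obtain x where x: "x \<in> carrier F" "v x = Fin a" by (rule value_attained)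
    obtain y where y: "y \<in> carrier F" "v y = Fin b" by (rule value_attained)
    from ab(3) obtain z where z: "z \<in> P" "v z = Fin (a + b)" by force
    have "x \<otimes> y \<in> P" using mono[OF z(1)] z(2) x y mult by simp
    then have "x \<in> P \<or> y \<in> P"
      using P.I_prime[of x y] x y ab by (simp add: zero_extended_def)
    with x y show ?thesis by force
  qed
  have "isolated_subgroup H"
    unfolding isolated_subgroup_def
  proof (intro conjI ballI allI impI)
    show "0 \<in> H"
    proof (rule ccontr)
      \<comment> \<open>An element of value 0 in \<open>P\<close> would by \<open>mono\<close> pull
        all of \<open>O_v\<close> into \<open>P\<close>.\<close>
      assume "0 \<notin> H"
      then obtain u where u: "u \<in> P" "v u = 0"
        by (auto simp: H_def zero_extended_def)
      have "x \<in> P" if "x \<in> carrier O_v" for x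
        using mono[OF u(1), of x] u(2) that by simp
      then have "P = carrier O_v" using P.Icarr by blast
      with P.I_notcarr show False by blast
    qed
    fix a b assume "a \<in> H" "b \<in> H"
    then have "Fin (?m a + ?m b) \<notin> v ` P"
      using plus[of "?m a" "?m b"] max_uminus_nonneg by (auto simp: H_def)
    moreover have "?m (a + b) \<le> ?m a + ?m b"
    proof -
      have "a + b \<le> ?m a + ?m b" "- a + - b \<le> ?m a + ?m b" by (intro add_mono; simp)+
      then show ?thesis by simp
    qed
    ultimately show "a + b \<in> H"
      unfolding H_def using up[of "?m (a + b)" "?m a + ?m b"] by blast
  next
    fix a assume "a \<in> H"
    then show "- a \<in> H" by (simp add: H_def max.commute)
  next
    fix h g assume h: "h \<in> H" "0 \<le> h" and g: "0 \<le> g \<and> g \<le> h"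
    then have "?m h = h" "?m g = g" by (auto simp: max_def)
    then show "g \<in> H" using up[of g h] h(1) g unfolding H_def by force
  qed
  moreover have "x \<in> P \<longleftrightarrow> x \<in> prime_of H" for x
  proof (cases "x \<in> carrier F \<and> 0 \<le> v x")
    case True
    show ?thesis
    proof (cases "x = \<zero>")
      case True
      moreover have "\<zero> \<in> P" using additive_subgroup.zero_closed[OF P.is_additive_subgroup] by simp
      ultimately show ?thesis using infinity_iff[of \<zero>] by (auto simp: prime_of_def)
    next
      case False
      with True obtain a where a: "v x = Fin a" using finite_value by blast
      then have "?m a = a" using True by (auto simp: max_def zero_extended_def)
      then have "x \<in> prime_of H \<longleftrightarrow> Fin a \<in> v ` P"
        using a True by (auto simp: prime_of_def H_def)
      also have "\<dots> \<longleftrightarrow> x \<in> P"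
      proof
        assume "Fin a \<in> v ` P"
        then obtain y where "y \<in> P" "v y = Fin a" by force
        then show "x \<in> P" using mono[of y x] a True by simp
      qed (use a in force)
      finally show ?thesis by simp
    qed
  qed (use PF in \<open>auto simp: prime_of_def\<close>)
  ultimately show thesis using that[of H] by blast
qed

lemma bij_betw_prime_of: "bij_betw prime_of isolated (Spec O_v)"
proof -
  have "inj_on prime_of isolated"
    by (rule inj_onI) (simp add: isolated_def set_eq_subset prime_of_subset_iff)
  moreover have "prime_of ` isolated = Spec O_v"
    unfolding isolated_def Spec_def using primeideal_prime_of
    by (blast elim: primeideal_imp_prime_of)
  ultimately show ?thesis by (simp add: bij_betw_def)
qed

text \<open>Comparability is transferred from the isolated subgroups.\<close>

lemma Spec_chain:
  assumes "P \<in> Spec O_v" "Q \<in> Spec O_v"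
  shows "P \<subseteq> Q \<or> Q \<subseteq> P"
proof -
  obtain H where H: "isolated_subgroup H" "P = prime_of H"
    using assms(1) unfolding Spec_def by (blast elim: primeideal_imp_prime_of)
  obtain H' where H': "isolated_subgroup H'" "Q = prime_of H'"
    using assms(2) unfolding Spec_def by (blast elim: primeideal_imp_prime_of)
  show ?thesis
    using isolated_subgroups_chain[OF H(1) H'(1)] prime_of_subset_iff H H' by blast
qed

lemma bij_betw_prime_of_IS_IP: "bij_betw prime_of (IS isolated) (IP (Spec O_v))"
  by (rule bij_betw_IS_IP[OF bij_betw_prime_of]) (simp add: isolated_def prime_of_subset_iff)

end

section \<open>Composition of the correspondences\<close>

theorem theorem3p5:
  fixes F :: "('f, 'm) ring_scheme"
    and v :: "'f \<Rightarrow> ('t::linorder, 'g::linordered_ab_group_add) lexfun extended"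
  assumes "rank_one TYPE('g)"
    and "surjective_valuation F v"
  shows "(bij_betw (H_sub :: 't \<Rightarrow> ('t, 'g) lexfun set) UNIV (IS isolated) \<and>
          (\<forall>s t :: 't. s \<le> t \<longleftrightarrow> (H_sub t :: ('t, 'g) lexfun set) \<subseteq> H_sub s)) \<and>
         (\<exists>\<phi> :: 't \<Rightarrow> 'f set. order_isomorphism \<phi> UNIV (IP (Spec (valuation_domain F v)))) \<and>
         (\<exists>\<psi> :: 't \<Rightarrow> 'f set. order_isomorphism \<psi> UNIV (IS (Spec (valuation_domain F v))))"
proof -
  interpret surjective_valuation F v by (rule assms(2))
  obtain c :: 'g where c: "c \<noteq> 0" using assms(1) by (auto simp: rank_one_def)
  note H_iff = H_sub_subset_iff[OF c, where 't = 't]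
  note bij = bij_betw_H_sub[OF assms(1), where 't = 't]
  \<comment> \<open>Both factors reverse the order, so the composite preserves it.\<close>
  define \<phi> :: "'t \<Rightarrow> 'f set" where "\<phi> = prime_of \<circ> H_sub"
  have \<phi>: "order_isomorphism \<phi> UNIV (IP (Spec O_v))"
    unfolding order_isomorphism_def \<phi>_def
    using bij_betw_trans[OF bij bij_betw_prime_of_IS_IP]
    by (simp add: H_iff flip: prime_of_subset_iff[OF isolated_subgroup_H_sub isolated_subgroup_H_sub])
  obtain f where "order_isomorphism f (IP (Spec O_v)) (IS (Spec O_v))"
    using chain_IP_isomorphic_IS[OF Spec_chain] .
  with \<phi> have "order_isomorphism (f \<circ> \<phi>) UNIV (IS (Spec O_v))"
    by (rule order_isomorphism_trans)
  with \<phi> bij show ?thesis by (auto simp: H_iff)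
qed

end
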